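(* Let $X$ be a d-space and $\alpha\in\{+,-,0\}$. The family of $\alpha$-inessential d-maps $X\to X$ is closed under composition. Likewise, the family of coherently $\alpha$-inessential d-maps $X\to X$ is closed under composition.
   Context: Let $I=[0,1]$. A d-space is a topological space $X$ together with a subspace $\vec{P}(X)\subset X^I$ (the d-paths) that contains the constant paths and is closed under concatenation and under non-decreasing continuous reparametrizations $p:I\to I$. A d-map $f:X\to Y$ between d-spaces is a continuous map with $f\circ p\in\vec{P}(Y)$ for all $p\in\vec{P}(X)$. $\vec{P}(X)_x^y$ is the subspace of d-paths from $x$ to $y$; $x\preceq y$ means $\vec{P}(X)_x^y\neq\emptyset$; $\vec{X^2}=\{(x,y)\in X^2\mid x\preceq y\}$. The trace space $\vec{T}(X)$ is the quotient of $\vec{P}(X)$ (quotient topology) under the equivalence relation generated by $p\sim p\circ\varphi$ for continuous non-decreasing $\varphi:I\to I$ with $\varphi(0)=0,\varphi(1)=1$; $\vec{T}(X)_x^y$ is the fibre over $(x,y)\in\vec{X^2}$ of the end-point map $\vec{e}_X:\vec{T}(X)\to\vec{X^2}$. A d-map $f:X\to Y$ induces $\vec{T}(f):\vec{T}(X)\to\vec{T}(Y)$, $\sigma\mapsto f\circ\sigma$, and restrictions $\vec{T}(f)_{x_1}^{x_2}:\vec{T}(X)_{x_1}^{x_2}\to\vec{T}(Y)_{fx_1}^{fx_2}$. A d-map $f$ is path space preserving (psp) if $\vec{T}(f)_{x_1}^{x_2}$ is a weak homotopy equivalence for all $(x_1,x_2)\in\vec{X^2}$. Intervals: $I$ as a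 d-space is $[0,1]$ with only constant d-paths (neutral interval); $\vec{I}$ is $[0,1]$ with the non-decreasing paths as d-paths; products carry the product d-structure. A d-homotopy from $H_0$ to $H_1$ is a d-map $H:X\times\vec{I}\to X$; a neutral d-homotopy is a d-map $H:X\times I\to X$. Either is psp if every $H_t=H(-,t)$ is psp. It is coherently psp if it is psp and, moreover, the map $\bigsqcup_t\vec{T}(H_t):\vec{T}(X)\times I\to(\vec{H^2})^*\vec{T}(X)$ over $\vec{X^2}\times I$ has a continuous fibre homotopy inverse (over $\vec{X^2}\times I$), where $(\vec{H^2})^*\vec{T}(X)$ is the pullback of $\vec{e}_X$ along $\vec{H^2}:\vec{X^2}\times I\to\vec{X^2}$, $(x_1,x_2,t)\mapsto(H_tx_1,H_tx_2)$. A d-map $f:X\to X$ is (coherently) $\alpha$-inessential if there is a (coherently) psp homotopy $H$ which is: for $\alpha=+$, a d-homotopy with $H_0=id_X,H_1=f$; for $\alpha=-$, a d-homotopy with $H_0=f,H_1=id_X$; for $\alpha=0$, a neutral d-homotopy with $H_0=id_X,H_1=f$. *)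

theory Defs
  imports "HOL-Analysis.Analysis"
begin

abbreviation unit_interval :: "real topology"
  where "unit_interval \<equiv> top_of_set {0..1}"


section \<open>Function spaces and quotients\<close>

text \<open>
  Maps out of a space are represented by functions that are extensional on its carrier, so that
  equality of functions is equality of maps. Accordingly, composition is
  \<^term>\<open>compose (topspace X) g f\<close>.
\<close>

definition compact_open_topology :: "'a topology \<Rightarrow> 'b topology \<Rightarrow> ('a \<Rightarrow> 'b) topology"
  where "compact_open_topology X Y = topology_generated_by
    {{f \<in> extensional (topspace X). continuous_map X Y f \<and> f ` K \<subseteq> U} |K U.
       compactin X K \<and> openin Y U}"

definition quotient_topology :: "'a topology \<Rightarrow> ('a \<Rightarrow> 'b) \<Rightarrow> 'b topology"
  where "quotient_topology X q = topology
    (\<lambda>U. U \<subseteq> q ` topspace X \<and> openin X {x \<in> topspace X. q x \<in> U})"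

lemma openin_quotient_topology:
  "openin (quotient_topology X q) U \<longleftrightarrow>
     U \<subseteq> q ` topspace X \<and> openin X {x \<in> topspace X. q x \<in> U}"
proof -
  have "istopology (\<lambda>U. U \<subseteq> q ` topspace X \<and> openin X {x \<in> topspace X. q x \<in> U})"
    unfolding istopology_def
  proof (intro conjI allI impI, goal_cases)
    case (1 S T)
    then show ?case by blast
  next
    case (2 S T)
    have "{x \<in> topspace X. q x \<in> S \<inter> T} =
      {x \<in> topspace X. q x \<in> S} \<inter> {x \<in> topspace X. q x \<in> T}" by blast
    then show ?case using 2 by (simp add: openin_Int)
  next
    case (3 \<K>)
    then show ?case by blast
  next
    case (4 \<K>)
    have "{x \<in> topspace X. q x \<in> \<Union>\<K>} = (\<Union>U\<in>\<K>. {x \<in> topspace X. q x \<in> U})" by blast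
    then show ?case using 4 by auto
  qed
  then show ?thesis by (simp add: quotient_topology_def topology_inverse')
qed


section \<open>Weak homotopy equivalences\<close>

definition cube :: "nat \<Rightarrow> (nat \<Rightarrow> real) topology"
  where "cube n = product_topology (\<lambda>_. unit_interval) {..<n}"

definition cube_boundary :: "nat \<Rightarrow> (nat \<Rightarrow> real) set"
  where "cube_boundary n = {s \<in> topspace (cube n). \<exists>i<n. s i = 0 \<or> s i = 1}"

definition spheroids :: "nat \<Rightarrow> 'a topology \<Rightarrow> 'a \<Rightarrow> ((nat \<Rightarrow> real) \<Rightarrow> 'a) set"
  where "spheroids n X x = {g \<in> extensional (topspace (cube n)).
    continuous_map (cube n) X g \<and> (\<forall>s \<in> cube_boundary n. g s = x)}"

definition spheroid_rel ::
    "nat \<Rightarrow> 'a topology \<Rightarrow> 'a \<Rightarrow> (((nat \<Rightarrow> real) \<Rightarrow> 'a) \<times> ((nat \<Rightarrow> real) \<Rightarrow> 'a)) set"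
  where "spheroid_rel n X x = {(g, h). g \<in> spheroids n X x \<and> h \<in> spheroids n X x \<and>
    homotopic_with (\<lambda>k. \<forall>s \<in> cube_boundary n. k s = x) (cube n) X g h}"

definition homotopy_group :: "nat \<Rightarrow> 'a topology \<Rightarrow> 'a \<Rightarrow> ((nat \<Rightarrow> real) \<Rightarrow> 'a) set set"
  where "homotopy_group n X x = spheroids n X x // spheroid_rel n X x"

definition homotopy_group_map ::
    "nat \<Rightarrow> 'b topology \<Rightarrow> ('a \<Rightarrow> 'b) \<Rightarrow> 'a \<Rightarrow>
     ((nat \<Rightarrow> real) \<Rightarrow> 'a) set \<Rightarrow> ((nat \<Rightarrow> real) \<Rightarrow> 'b) set"
  where "homotopy_group_map n Y f x c =
    spheroid_rel n Y (f x) `` (compose (topspace (cube n)) f ` c)"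

definition path_components_map :: "'b topology \<Rightarrow> ('a \<Rightarrow> 'b) \<Rightarrow> 'a set \<Rightarrow> 'b set"
  where "path_components_map Y f c = (\<Union>x\<in>c. path_component_of_set Y (f x))"

text \<open>
  For \<open>n \<ge> 1\<close> the induced map on \<open>n\<close>-th homotopy groups is always a homomorphism (the product is
  juxtaposition of cubes, which commutes with postcomposition), so it is an isomorphism
  exactly when it is bijective.
\<close>

definition weak_homotopy_equivalence :: "'a topology \<Rightarrow> 'b topology \<Rightarrow> ('a \<Rightarrow> 'b) \<Rightarrow> bool"
  where "weak_homotopy_equivalence X Y f \<longleftrightarrow>
    continuous_map X Y f \<and>
    bij_betw (path_components_map Y f) (path_components_of X) (path_components_of Y) \<and>
    (\<forall>n\<ge>1. \<forall>x \<in> topspace X.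
       bij_betw (homotopy_group_map n Y f x) (homotopy_group n X x) (homotopy_group n Y (f x)))"


section \<open>Fibre homotopy equivalences\<close>

text \<open>
  Spaces over a common base are given by their structure maps \<open>p\<close>, \<open>q\<close> into the base.
\<close>

definition map_over :: "'a topology \<Rightarrow> ('a \<Rightarrow> 'c) \<Rightarrow> 'b topology \<Rightarrow> ('b \<Rightarrow> 'c) \<Rightarrow> ('a \<Rightarrow> 'b) \<Rightarrow> bool"
  where "map_over E p E' q F \<longleftrightarrow>
    continuous_map E E' F \<and> (\<forall>e \<in> topspace E. q (F e) = p e)"

definition fibre_homotopic ::
    "'a topology \<Rightarrow> ('a \<Rightarrow> 'c) \<Rightarrow> 'b topology \<Rightarrow> ('b \<Rightarrow> 'c) \<Rightarrow> ('a \<Rightarrow> 'b) \<Rightarrow> ('a \<Rightarrow> 'b) \<Rightarrow> bool"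
  where "fibre_homotopic E p E' q F G \<longleftrightarrow>
    homotopic_with (\<lambda>h. \<forall>e \<in> topspace E. q (h e) = p e) E E' F G"

definition fibre_homotopy_equivalence ::
    "'a topology \<Rightarrow> ('a \<Rightarrow> 'c) \<Rightarrow> 'b topology \<Rightarrow> ('b \<Rightarrow> 'c) \<Rightarrow> ('a \<Rightarrow> 'b) \<Rightarrow> bool"
  where "fibre_homotopy_equivalence E p E' q F \<longleftrightarrow>
    map_over E p E' q F \<and>
    (\<exists>G. map_over E' q E p G \<and>
       fibre_homotopic E p E p (G \<circ> F) id \<and>
       fibre_homotopic E' q E' q (F \<circ> G) id)"


section \<open>d-spaces and d-maps\<close>

record 'a dspace =
  dtop :: "'a topology"
  dpaths :: "(real \<Rightarrow> 'a) set"

definition const_path :: "'a \<Rightarrow> real \<Rightarrow> 'a"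
  where "const_path x = (\<lambda>t\<in>{0..1}. x)"

definition concat_path :: "(real \<Rightarrow> 'a) \<Rightarrow> (real \<Rightarrow> 'a) \<Rightarrow> real \<Rightarrow> 'a"
  where "concat_path p q = (\<lambda>t\<in>{0..1}. if t \<le> 1/2 then p (2 * t) else q (2 * t - 1))"

text \<open>Not necessarily surjective: restrictions to subintervals are included.\<close>

definition reparametrization :: "(real \<Rightarrow> real) \<Rightarrow> bool"
  where "reparametrization \<phi> \<longleftrightarrow>
    continuous_map unit_interval unit_interval \<phi> \<and> mono_on {0..1} \<phi>"

definition is_dspace :: "'a dspace \<Rightarrow> bool"
  where "is_dspace X \<longleftrightarrow>
    dpaths X \<subseteq> {p \<in> extensional {0..1}. continuous_map unit_interval (dtop X) p} \<and>
    (\<forall>x \<in> topspace (dtop X). const_path x \<in> dpaths X) \<and>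
    (\<forall>p \<in> dpaths X. \<forall>q \<in> dpaths X. p 1 = q 0 \<longrightarrow> concat_path p q \<in> dpaths X) \<and>
    (\<forall>p \<in> dpaths X. \<forall>\<phi>. reparametrization \<phi> \<longrightarrow> compose {0..1} p \<phi> \<in> dpaths X)"

definition dmap :: "'a dspace \<Rightarrow> 'b dspace \<Rightarrow> ('a \<Rightarrow> 'b) \<Rightarrow> bool"
  where "dmap X Y f \<longleftrightarrow>
    continuous_map (dtop X) (dtop Y) f \<and> (\<forall>p \<in> dpaths X. compose {0..1} f p \<in> dpaths Y)"

definition neutral_interval :: "real dspace"
  where "neutral_interval = \<lparr>dtop = unit_interval, dpaths = const_path ` {0..1}\<rparr>"

definition directed_interval :: "real dspace"
  where "directed_interval = \<lparr>dtop = unit_interval,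
    dpaths = {p \<in> extensional {0..1}. reparametrization p}\<rparr>"

definition dprod :: "'a dspace \<Rightarrow> 'b dspace \<Rightarrow> ('a \<times> 'b) dspace"
  where "dprod X Y = \<lparr>dtop = prod_topology (dtop X) (dtop Y),
    dpaths = {p \<in> extensional {0..1}.
      compose {0..1} fst p \<in> dpaths X \<and> compose {0..1} snd p \<in> dpaths Y}\<rparr>"


section \<open>Trace spaces\<close>

definition path_space :: "'a dspace \<Rightarrow> (real \<Rightarrow> 'a) topology"
  where "path_space X = subtopology (compact_open_topology unit_interval (dtop X)) (dpaths X)"

definition reachable_pairs :: "'a dspace \<Rightarrow> ('a \<times> 'a) set"
  where "reachable_pairs X = {(x, y). \<exists>p \<in> dpaths X. p 0 = x \<and> p 1 = y}"

definition reachable_space :: "'a dspace \<Rightarrow> ('a \<times> 'a) topology"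
  where "reachable_space X =
    subtopology (prod_topology (dtop X) (dtop X)) (reachable_pairs X)"

definition reparam_step :: "'a dspace \<Rightarrow> ((real \<Rightarrow> 'a) \<times> (real \<Rightarrow> 'a)) set"
  where "reparam_step X = {(p, compose {0..1} p \<phi>) |p \<phi>.
    p \<in> dpaths X \<and> reparametrization \<phi> \<and> \<phi> 0 = 0 \<and> \<phi> 1 = 1}"

definition trace_rel :: "'a dspace \<Rightarrow> ((real \<Rightarrow> 'a) \<times> (real \<Rightarrow> 'a)) set"
  where "trace_rel X = Restr ((reparam_step X \<union> (reparam_step X)\<inverse>)\<^sup>*) (dpaths X)"

definition trace_of :: "'a dspace \<Rightarrow> (real \<Rightarrow> 'a) \<Rightarrow> (real \<Rightarrow> 'a) set"
  where "trace_of X p = trace_rel X `` {p}"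

definition trace_space :: "'a dspace \<Rightarrow> (real \<Rightarrow> 'a) set topology"
  where "trace_space X = quotient_topology (path_space X) (trace_of X)"

definition trace_ends :: "(real \<Rightarrow> 'a) set \<Rightarrow> 'a \<times> 'a"
  where "trace_ends \<sigma> = (THE e. \<exists>p\<in>\<sigma>. e = (p 0, p 1))"

lemma trace_ends_trace_of:
  assumes "p \<in> dpaths X"
  shows "trace_ends (trace_of X p) = (p 0, p 1)"
proof -
  have "(q 0, q 1) = (p 0, p 1)"
    if "(p, q) \<in> (reparam_step X \<union> (reparam_step X)\<inverse>)\<^sup>*" for q
    using that
    by (induction rule: rtrancl_induct) (auto simp: reparam_step_def compose_def)
  moreover have "p \<in> trace_of X p"
    using assms by (simp add: trace_of_def trace_rel_def)
  ultimately show ?thesis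
    unfolding trace_ends_def trace_of_def trace_rel_def
    by (intro the_equality) auto
qed

definition trace_fibre :: "'a dspace \<Rightarrow> 'a \<Rightarrow> 'a \<Rightarrow> (real \<Rightarrow> 'a) set topology"
  where "trace_fibre X x y =
    subtopology (trace_space X) {\<sigma> \<in> topspace (trace_space X). trace_ends \<sigma> = (x, y)}"

definition trace_map :: "'b dspace \<Rightarrow> ('a \<Rightarrow> 'b) \<Rightarrow> (real \<Rightarrow> 'a) set \<Rightarrow> (real \<Rightarrow> 'b) set"
  where "trace_map Y f \<sigma> = trace_rel Y `` (compose {0..1} f ` \<sigma>)"

lemma trace_map_trace_of:
  assumes f: "dmap X Y f" and p: "p \<in> dpaths X"
  shows "trace_map Y f (trace_of X p) = trace_of Y (compose {0..1} f p)"
proof -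
  let ?c = "compose {0..1} f"
  let ?SX = "reparam_step X \<union> (reparam_step X)\<inverse>"
  let ?SY = "reparam_step Y \<union> (reparam_step Y)\<inverse>"
  have step: "(?c a, ?c b) \<in> reparam_step Y" if ab: "(a, b) \<in> reparam_step X" for a b
  proof -
    obtain \<phi> where \<phi>: "b = compose {0..1} a \<phi>" "a \<in> dpaths X" "reparametrization \<phi>"
        "\<phi> 0 = 0" "\<phi> 1 = 1"
      using ab by (auto simp: reparam_step_def)
    have "\<phi> t \<in> {0..1}" if "t \<in> {0..1}" for t
      using \<phi>(3) that by (auto simp: reparametrization_def continuous_map_def)
    then have "?c b = compose {0..1} (?c a) \<phi>"
      using \<phi>(1) by (auto simp: compose_def)
    moreover have "?c a \<in> dpaths Y" using f \<phi>(2) by (auto simp: dmap_def)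
    ultimately show ?thesis using \<phi> by (auto simp: reparam_step_def)
  qed
  have 1: "(?c p, ?c q) \<in> ?SY\<^sup>*" if "(p, q) \<in> ?SX\<^sup>*" for q
    using that
  proof (induction rule: rtrancl_induct)
    case (step y z)
    then have "(?c y, ?c z) \<in> ?SY"
      using \<open>\<And>a b. (a, b) \<in> reparam_step X \<Longrightarrow> (?c a, ?c b) \<in> reparam_step Y\<close> by auto
    with step.IH show ?case by (rule rtrancl_into_rtrancl)
  qed simp
  have cp: "?c p \<in> dpaths Y" using f p by (auto simp: dmap_def)
  show ?thesis
  proof (intro equalityI subsetI)
    fix r assume "r \<in> trace_map Y f (trace_of X p)"
    then obtain q where "(p, q) \<in> ?SX\<^sup>*" "(?c q, r) \<in> ?SY\<^sup>*" "r \<in> dpaths Y"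
      by (auto simp: trace_map_def trace_of_def trace_rel_def)
    then show "r \<in> trace_of Y (?c p)"
      using 1 cp by (auto simp: trace_of_def trace_rel_def intro: rtrancl_trans)
  next
    fix r assume "r \<in> trace_of Y (?c p)"
    moreover have "p \<in> trace_of X p" using p by (simp add: trace_of_def trace_rel_def)
    ultimately show "r \<in> trace_map Y f (trace_of X p)"
      by (auto simp: trace_map_def trace_of_def)
  qed
qed


section \<open>Path space preserving homotopies and inessential d-maps\<close>

definition psp :: "'a dspace \<Rightarrow> 'b dspace \<Rightarrow> ('a \<Rightarrow> 'b) \<Rightarrow> bool"
  where "psp X Y f \<longleftrightarrow> dmap X Y f \<and>
    (\<forall>(x1, x2) \<in> reachable_pairs X.
       weak_homotopy_equivalence (trace_fibre X x1 x2) (trace_fibre Y (f x1) (f x2))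
         (trace_map Y f))"

definition psp_homotopy :: "'a dspace \<Rightarrow> ('a \<times> real \<Rightarrow> 'a) \<Rightarrow> bool"
  where "psp_homotopy X H \<longleftrightarrow> (\<forall>t \<in> {0..1}. psp X X (\<lambda>x. H (x, t)))"

definition trace_pullback ::
    "'a dspace \<Rightarrow> ('a \<times> real \<Rightarrow> 'a) \<Rightarrow> ((('a \<times> 'a) \<times> real) \<times> (real \<Rightarrow> 'a) set) topology"
  where "trace_pullback X H =
    subtopology (prod_topology (prod_topology (reachable_space X) unit_interval) (trace_space X))
      {(((x1, x2), t), \<sigma>) |x1 x2 t \<sigma>. trace_ends \<sigma> = (H (x1, t), H (x2, t))}"

definition coherently_psp_homotopy :: "'a dspace \<Rightarrow> ('a \<times> real \<Rightarrow> 'a) \<Rightarrow> bool"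
  where "coherently_psp_homotopy X H \<longleftrightarrow>
    psp_homotopy X H \<and>
    fibre_homotopy_equivalence
      (prod_topology (trace_space X) unit_interval) (\<lambda>(\<sigma>, t). (trace_ends \<sigma>, t))
      (trace_pullback X H) fst
      (\<lambda>(\<sigma>, t). ((trace_ends \<sigma>, t), trace_map X (\<lambda>x. H (x, t)) \<sigma>))"

definition is_homotopy ::
    "real dspace \<Rightarrow> 'a dspace \<Rightarrow> ('a \<Rightarrow> 'a) \<Rightarrow> ('a \<Rightarrow> 'a) \<Rightarrow> ('a \<times> real \<Rightarrow> 'a) \<Rightarrow> bool"
  where "is_homotopy J X f g H \<longleftrightarrow>
    dmap (dprod X J) X H \<and>
    (\<forall>x \<in> topspace (dtop X). H (x, 0) = f x) \<and> (\<forall>x \<in> topspace (dtop X). H (x, 1) = g x)"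

abbreviation "d_homotopy \<equiv> is_homotopy directed_interval"
abbreviation "neutral_d_homotopy \<equiv> is_homotopy neutral_interval"

datatype sign = Plus | Minus | Zero

fun sign_homotopy :: "sign \<Rightarrow> 'a dspace \<Rightarrow> ('a \<Rightarrow> 'a) \<Rightarrow> ('a \<times> real \<Rightarrow> 'a) \<Rightarrow> bool"
  where
    "sign_homotopy Plus X f H \<longleftrightarrow> d_homotopy X id f H"
  | "sign_homotopy Minus X f H \<longleftrightarrow> d_homotopy X f id H"
  | "sign_homotopy Zero X f H \<longleftrightarrow> neutral_d_homotopy X id f H"

definition inessential :: "sign \<Rightarrow> 'a dspace \<Rightarrow> ('a \<Rightarrow> 'a) \<Rightarrow> bool"
  where "inessential \<alpha> X f \<longleftrightarrow>
    dmap X X f \<and> (\<exists>H. sign_homotopy \<alpha> X f H \<and> psp_homotopy X H)"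

definition coherently_inessential :: "sign \<Rightarrow> 'a dspace \<Rightarrow> ('a \<Rightarrow> 'a) \<Rightarrow> bool"
  where "coherently_inessential \<alpha> X f \<longleftrightarrow>
    dmap X X f \<and> (\<exists>H. sign_homotopy \<alpha> X f H \<and> coherently_psp_homotopy X H)"

end

theory Submission
  imports Defs
begin

text \<open>
  Let \<open>H\<close> and \<open>G\<close> be homotopies witnessing that \<open>f\<close> and \<open>g\<close> are inessential. Concatenating
  homotopies would force a change of the time parameter and a gluing of fibre homotopy inverses.
  The diagonal composite \<open>K(x, t) = G(H(x, t), t)\<close> avoids both: it satisfies
  \<open>K\<^sub>t = G\<^sub>t \<circ> H\<^sub>t\<close> at every time, so its ends are the composites of the ends, in all three
  variance cases at once. It is a d-map on the product with any interval, because
  \<open>(x, t) \<mapsto> (H(x, t), t)\<close> is one. It is psp because \<open>\<sigma> \<mapsto> T(K\<^sub>t)\<sigma>\<close> is \<open>T(G\<^sub>t) \<circ> T(H\<^sub>t)\<close> and weak homotopy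
  equivalences compose (\<open>weak_homotopy_equivalence_compose\<close>).

  For coherence, write \<open>T\<close> for the trace space, \<open>A\<close> for the space of reachable pairs times the unit
  interval, and \<open>h : A \<rightarrow> A\<close> for the map that applies \<open>H\<^sub>t\<close> to both ends and keeps \<open>t\<close>. As spaces
  over \<open>A\<close>, the target \<open>(H\<^sup>2)\<^sup>*T\<close> of the comparison map \<open>\<Phi>\<^sub>H\<close> of \<open>H\<close> is the pullback \<open>h\<^sup>*(T \<times> I)\<close> of the
  source of \<open>\<Phi>\<^sub>G\<close>, and \<open>(K\<^sup>2)\<^sup>*T\<close> is the pullback \<open>h\<^sup>*((G\<^sup>2)\<^sup>*T)\<close> of the target of \<open>\<Phi>\<^sub>G\<close>. Under these
  fibre homeomorphisms \<open>\<Phi>\<^sub>K = h\<^sup>*\<Phi>\<^sub>G \<circ> \<Phi>\<^sub>H\<close>, and fibre homotopy equivalences are stable under pullback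
  (\<open>fibre_homotopy_equivalence_pullback\<close>) and composition
  (\<open>fibre_homotopy_equivalence_compose\<close>).
\<close>


section \<open>Weak homotopy equivalences compose\<close>

lemma path_components_map_component:
  assumes "continuous_map X Y f" and "x \<in> topspace X"
  shows "path_components_map Y f (path_component_of_set X x) = path_component_of_set Y (f x)"
proof -
  have "path_component_of_set Y (f y) = path_component_of_set Y (f x)"
    if "path_component_of X x y" for y
    using path_component_of_continuous_image[OF assms(1) that] path_component_of_equiv by metis
  moreover have "path_component_of X x x"
    using assms(2) by (simp add: path_component_of_refl)
  ultimately show ?thesis
    unfolding path_components_map_def by blast
qed

lemma spheroid_rel_trans:
  "(g, h) \<in> spheroid_rel n X x \<Longrightarrow> (h, k) \<in> spheroid_rel n X x \<Longrightarrow> (g, k) \<in> spheroid_rel n X x"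
  unfolding spheroid_rel_def using homotopic_with_trans by fastforce

lemma spheroid_rel_refl: "g \<in> spheroids n X x \<Longrightarrow> (g, g) \<in> spheroid_rel n X x"
  by (auto simp: spheroid_rel_def spheroids_def)

lemma compose_spheroid:
  assumes f: "continuous_map X Y f" and g: "g \<in> spheroids n X x"
  shows "compose (topspace (cube n)) f g \<in> spheroids n Y (f x)"
proof -
  have "continuous_map (cube n) Y (f \<circ> g)"
    using f g by (auto simp: spheroids_def intro: continuous_map_compose)
  then have "continuous_map (cube n) Y (compose (topspace (cube n)) f g)"
    by (rule continuous_map_eq) (simp add: compose_def)
  moreover have "s \<in> topspace (cube n)" if "s \<in> cube_boundary n" for s
    using that by (auto simp: cube_boundary_def)
  ultimately show ?thesis
    using g by (auto simp: spheroids_def compose_def)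
qed

lemma compose_spheroid_rel:
  assumes f: "continuous_map X Y f" and gh: "(g, h) \<in> spheroid_rel n X x"
  shows "(compose (topspace (cube n)) f g, compose (topspace (cube n)) f h)
    \<in> spheroid_rel n Y (f x)"
proof -
  let ?P = "\<lambda>y k. \<forall>s \<in> cube_boundary n. k s = y"
  have "homotopic_with (?P x) (cube n) X g h"
    using gh by (simp add: spheroid_rel_def)
  then have "homotopic_with (?P (f x)) (cube n) Y (f \<circ> g) (f \<circ> h)"
    by (rule homotopic_with_compose_continuous_map_left[OF _ f]) simp
  then have "homotopic_with (?P (f x)) (cube n) Y
      (compose (topspace (cube n)) f g) (compose (topspace (cube n)) f h)"
    by (rule homotopic_with_eq) (auto simp: compose_def cube_boundary_def)
  then show ?thesis
    using gh compose_spheroid[OF f] by (simp add: spheroid_rel_def)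
qed

text \<open>
  The induced map is defined as the saturation of the image of a whole class. This computes it on
  one representative: composing with \<open>f\<close> turns homotopies of spheroids into homotopies of spheroids,
  so the image of the class already lies in a single class.
\<close>

lemma homotopy_group_map_class:
  assumes f: "continuous_map X Y f" and g: "g \<in> spheroids n X x"
  shows "homotopy_group_map n Y f x (spheroid_rel n X x `` {g}) =
    spheroid_rel n Y (f x) `` {compose (topspace (cube n)) f g}"
proof -
  let ?c = "compose (topspace (cube n)) f"
  have "(?c g, k) \<in> spheroid_rel n Y (f x)"
    if "(g, h) \<in> spheroid_rel n X x" and "(?c h, k) \<in> spheroid_rel n Y (f x)" for h k
    using compose_spheroid_rel[OF f that(1)] that(2) by (rule spheroid_rel_trans)
  then show ?thesis
    using spheroid_rel_refl[OF g] by (auto simp: homotopy_group_map_def)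
qed

lemma homotopy_group_map_compose:
  assumes f: "continuous_map X Y f" and g: "continuous_map Y Z g"
    and h: "\<And>x. x \<in> topspace X \<Longrightarrow> h x = g (f x)"
    and x: "x \<in> topspace X" and c: "c \<in> homotopy_group n X x"
  shows "homotopy_group_map n Z h x c =
    homotopy_group_map n Z g (f x) (homotopy_group_map n Y f x c)"
proof -
  obtain k where k: "k \<in> spheroids n X x" and c: "c = spheroid_rel n X x `` {k}"
    using c by (auto simp: homotopy_group_def elim: quotientE)
  have h': "continuous_map X Z h"
    using continuous_map_compose[OF f g] by (rule continuous_map_eq) (simp add: h)
  have "k s \<in> topspace X" if "s \<in> topspace (cube n)" for s
    using k that by (auto simp: spheroids_def continuous_map_def)
  then have "compose (topspace (cube n)) h k =
      compose (topspace (cube n)) g (compose (topspace (cube n)) f k)"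
    by (auto simp: compose_def h)
  then show ?thesis
    unfolding c homotopy_group_map_class[OF f k] homotopy_group_map_class[OF h' k]
      homotopy_group_map_class[OF g compose_spheroid[OF f k]]
    by (simp add: h x)
qed

text \<open>
  The composite is taken to be any \<open>h\<close> that agrees with \<open>g \<circ> f\<close> on points of the space: induced
  maps of traces are functorial only there, not on arbitrary sets of paths.
\<close>

lemma weak_homotopy_equivalence_compose:
  assumes f: "weak_homotopy_equivalence X Y f" and g: "weak_homotopy_equivalence Y Z g"
    and h: "\<And>x. x \<in> topspace X \<Longrightarrow> h x = g (f x)"
  shows "weak_homotopy_equivalence X Z h"
proof -
  have cf: "continuous_map X Y f" and cg: "continuous_map Y Z g"
    using f g by (auto simp: weak_homotopy_equivalence_def)
  have ch: "continuous_map X Z h"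
    using continuous_map_compose[OF cf cg] by (rule continuous_map_eq) (simp add: h)
  have fY: "f x \<in> topspace Y" if "x \<in> topspace X" for x
    using cf that by (auto simp: continuous_map_def)
  have "bij_betw (path_components_map Z g \<circ> path_components_map Y f)
      (path_components_of X) (path_components_of Z)"
    using f g by (auto simp: weak_homotopy_equivalence_def intro: bij_betw_trans)
  moreover have "(path_components_map Z g \<circ> path_components_map Y f) c = path_components_map Z h c"
    if "c \<in> path_components_of X" for c
    using that cf cg ch
    by (auto simp: path_components_of_def path_components_map_component fY h)
  ultimately have "bij_betw (path_components_map Z h)
      (path_components_of X) (path_components_of Z)"
    by (simp cong: bij_betw_cong)
  moreover have "bij_betw (homotopy_group_map n Z h x)
      (homotopy_group n X x) (homotopy_group n Z (h x))"
    if n: "n \<ge> 1" and x: "x \<in> topspace X" for n x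
  proof -
    have "bij_betw (homotopy_group_map n Z g (f x) \<circ> homotopy_group_map n Y f x)
        (homotopy_group n X x) (homotopy_group n Z (h x))"
      using f g n x fY h by (auto simp: weak_homotopy_equivalence_def intro!: bij_betw_trans)
    then show ?thesis
      by (simp add: homotopy_group_map_compose[OF cf cg h x] cong: bij_betw_cong)
  qed
  ultimately show ?thesis
    using ch by (simp add: weak_homotopy_equivalence_def)
qed


section \<open>Fibre homotopy equivalences: composition and pullback\<close>

lemma map_over_topspace: "map_over E p E' q F \<Longrightarrow> e \<in> topspace E \<Longrightarrow> F e \<in> topspace E'"
  by (auto simp: map_over_def continuous_map_def)

lemma map_over_compose:
  assumes F: "map_over E p E' q F" and F': "map_over E' q E'' r F'"
  shows "map_over E p E'' r (F' \<circ> F)"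
  unfolding map_over_def
proof (intro conjI ballI)
  show "continuous_map E E'' (F' \<circ> F)"
    using F F' by (auto simp: map_over_def intro: continuous_map_compose)
  show "r ((F' \<circ> F) e) = p e" if "e \<in> topspace E" for e
    using F F' map_over_topspace[OF F that] that by (simp add: map_over_def)
qed

text \<open>
  The predicate in \<^const>\<open>fibre_homotopic\<close> does not say that a stage of the homotopy takes values
  in \<open>E'\<close>, but that is where \<open>K\<close> is known to be a map over the base. Hence continuity of the stages
  is first added to the predicate.
\<close>

lemma fibre_homotopic_compose_left:
  assumes "fibre_homotopic E p E' q F G" and K: "map_over E' q E'' r K"
  shows "fibre_homotopic E p E'' r (K \<circ> F) (K \<circ> G)"
proof -
  have "homotopic_with (\<lambda>h. continuous_map E E' h \<and> (\<forall>e \<in> topspace E. q (h e) = p e)) E E' F G"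
    using assms(1) unfolding fibre_homotopic_def by (rule homotopic_with_mono) simp
  then show ?thesis
    unfolding fibre_homotopic_def
  proof (rule homotopic_with_compose_continuous_map_left)
    show "continuous_map E' E'' K" using K by (simp add: map_over_def)
    show "\<forall>e \<in> topspace E. r ((K \<circ> j) e) = p e"
      if "continuous_map E E' j \<and> (\<forall>e \<in> topspace E. q (j e) = p e)" for j
      using K that by (auto simp: map_over_def continuous_map_def Pi_iff)
  qed
qed

lemma fibre_homotopic_compose_right:
  assumes "fibre_homotopic E p E' q F G" and K: "map_over D r E p K"
  shows "fibre_homotopic D r E' q (F \<circ> K) (G \<circ> K)"
  using assms(1) unfolding fibre_homotopic_def
proof (rule homotopic_with_compose_continuous_map_right)
  show "continuous_map D E K" using K by (simp add: map_over_def)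
  show "\<forall>e \<in> topspace D. q ((j \<circ> K) e) = r e" if "\<forall>e \<in> topspace E. q (j e) = p e" for j
    using K that map_over_topspace[OF K] by (auto simp: map_over_def)
qed

lemma fibre_homotopic_trans:
  "fibre_homotopic E p E' q F G \<Longrightarrow> fibre_homotopic E p E' q G H \<Longrightarrow> fibre_homotopic E p E' q F H"
  unfolding fibre_homotopic_def by (rule homotopic_with_trans)

lemma fibre_homotopic_eq:
  assumes "fibre_homotopic E p E' q F G"
    and "\<And>e. e \<in> topspace E \<Longrightarrow> F' e = F e" and "\<And>e. e \<in> topspace E \<Longrightarrow> G' e = G e"
  shows "fibre_homotopic E p E' q F' G'"
  using assms unfolding fibre_homotopic_def by (rule homotopic_with_eq) auto

lemma fibre_homotopy_equivalence_eq:
  assumes F: "fibre_homotopy_equivalence E p E' q F"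
    and eq: "\<And>e. e \<in> topspace E \<Longrightarrow> F' e = F e"
  shows "fibre_homotopy_equivalence E p E' q F'"
proof -
  obtain G where F0: "map_over E p E' q F" and G: "map_over E' q E p G"
    and GF: "fibre_homotopic E p E p (G \<circ> F) id"
    and FG: "fibre_homotopic E' q E' q (F \<circ> G) id"
    using F by (auto simp: fibre_homotopy_equivalence_def)
  have "map_over E p E' q F'"
    using F0 continuous_map_eq[of E E' F F'] by (simp add: map_over_def eq)
  moreover have "fibre_homotopic E p E p (G \<circ> F') id"
    using GF by (rule fibre_homotopic_eq) (simp_all add: eq)
  moreover have "fibre_homotopic E' q E' q (F' \<circ> G) id"
    using FG by (rule fibre_homotopic_eq) (simp_all add: eq map_over_topspace[OF G])
  ultimately show ?thesis
    using G by (auto simp: fibre_homotopy_equivalence_def)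
qed

text \<open>
  With inverses \<open>G\<close> of \<open>F\<close> and \<open>G'\<close> of \<open>F'\<close>, contract the inner pair of \<open>G \<circ> G' \<circ> F' \<circ> F\<close> to the
  identity first and the outer pair afterwards; dually on the other side.
\<close>

lemma fibre_homotopy_equivalence_compose:
  assumes F: "fibre_homotopy_equivalence E p E' q F"
    and F': "fibre_homotopy_equivalence E' q E'' r F'"
  shows "fibre_homotopy_equivalence E p E'' r (F' \<circ> F)"
proof -
  obtain G where F0: "map_over E p E' q F" and G: "map_over E' q E p G"
    and GF: "fibre_homotopic E p E p (G \<circ> F) id"
    and FG: "fibre_homotopic E' q E' q (F \<circ> G) id"
    using F by (auto simp: fibre_homotopy_equivalence_def)
  obtain G' where F0': "map_over E' q E'' r F'" and G': "map_over E'' r E' q G'"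
    and GF': "fibre_homotopic E' q E' q (G' \<circ> F') id"
    and FG': "fibre_homotopic E'' r E'' r (F' \<circ> G') id"
    using F' by (auto simp: fibre_homotopy_equivalence_def)
  have "fibre_homotopic E p E p (G \<circ> (G' \<circ> F') \<circ> F) (G \<circ> id \<circ> F)"
    by (intro fibre_homotopic_compose_right[OF _ F0] fibre_homotopic_compose_left[OF _ G] GF')
  then have 1: "fibre_homotopic E p E p ((G \<circ> G') \<circ> (F' \<circ> F)) id"
    using GF by (simp add: comp_assoc fibre_homotopic_trans)
  have "fibre_homotopic E'' r E'' r (F' \<circ> (F \<circ> G) \<circ> G') (F' \<circ> id \<circ> G')"
    by (intro fibre_homotopic_compose_right[OF _ G'] fibre_homotopic_compose_left[OF _ F0'] FG)
  then have 2: "fibre_homotopic E'' r E'' r ((F' \<circ> F) \<circ> (G \<circ> G')) id"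
    using FG' by (simp add: comp_assoc fibre_homotopic_trans)
  show ?thesis
    unfolding fibre_homotopy_equivalence_def
    using 1 2 map_over_compose[OF F0 F0'] map_over_compose[OF G' G] by blast
qed

lemma fibre_homeomorphism_imp_fibre_homotopy_equivalence:
  assumes F: "map_over E p E' q F" and G: "map_over E' q E p G"
    and "\<And>e. e \<in> topspace E \<Longrightarrow> G (F e) = e" and "\<And>e. e \<in> topspace E' \<Longrightarrow> F (G e) = e"
  shows "fibre_homotopy_equivalence E p E' q F"
proof -
  have "fibre_homotopic E p E p (G \<circ> F) id"
    using map_over_compose[OF F G] assms(3) unfolding fibre_homotopic_def map_over_def
    by (intro homotopic_with_equal) auto
  moreover have "fibre_homotopic E' q E' q (F \<circ> G) id"
    using map_over_compose[OF G F] assms(4) unfolding fibre_homotopic_def map_over_def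
    by (intro homotopic_with_equal) auto
  ultimately show ?thesis
    using F G by (auto simp: fibre_homotopy_equivalence_def)
qed

definition pullback_space ::
    "'b topology \<Rightarrow> ('b \<Rightarrow> 'c) \<Rightarrow> 'a topology \<Rightarrow> ('a \<Rightarrow> 'c) \<Rightarrow> ('b \<times> 'a) topology"
  where "pullback_space A r E p = subtopology (prod_topology A E) {(a, e). r a = p e}"

lemma continuous_map_pullback_space:
  "continuous_map Z (pullback_space A r E p) k \<longleftrightarrow>
    continuous_map Z A (fst \<circ> k) \<and> continuous_map Z E (snd \<circ> k) \<and>
    (\<forall>z \<in> topspace Z. r (fst (k z)) = p (snd (k z)))"
  by (auto simp: pullback_space_def continuous_map_in_subtopology continuous_map_componentwise
      continuous_map_pairwise Pi_iff split_beta)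

lemma topspace_pullback_space:
  "topspace (pullback_space A r E p) = {(a, e). a \<in> topspace A \<and> e \<in> topspace E \<and> r a = p e}"
  by (auto simp: pullback_space_def)

lemma continuous_map_pullback_fst: "continuous_map (pullback_space A r E p) A fst"
  and continuous_map_pullback_snd: "continuous_map (pullback_space A r E p) E snd"
  by (simp_all add: pullback_space_def continuous_map_from_subtopology
      continuous_map_fst continuous_map_snd)

lemma map_over_pullback:
  assumes F: "map_over E p E' q F"
  shows "map_over (pullback_space A r E p) fst (pullback_space A r E' q) fst (map_prod id F)"
proof -
  have "continuous_map (pullback_space A r E p) E' (F \<circ> snd)"
    using F by (auto simp: map_over_def intro: continuous_map_compose[OF continuous_map_pullback_snd])
  then show ?thesis
    using F continuous_map_pullback_fst[of A r E p]
    by (auto simp: map_over_def continuous_map_pullback_space topspace_pullback_space o_def)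
qed

text \<open>
  A fibre homotopy never leaves the fibre over the base point of \<open>e\<close>, so running it in the second
  coordinate of \<open>(a, e)\<close> preserves the equation that defines the pullback.
\<close>

lemma fibre_homotopic_pullback:
  assumes "fibre_homotopic E p E' q F G"
  shows "fibre_homotopic (pullback_space A r E p) fst (pullback_space A r E' q) fst
    (map_prod id F) (map_prod id G)"
proof -
  let ?I = "top_of_set {0..1::real}" and ?P = "pullback_space A r E p"
  obtain k where k: "continuous_map (prod_topology ?I E) E' k"
    and k0: "\<And>e. k (0, e) = F e" and k1: "\<And>e. k (1, e) = G e"
    and kp: "\<And>t e. t \<in> {0..1} \<Longrightarrow> e \<in> topspace E \<Longrightarrow> q (k (t, e)) = p e"
    using assms unfolding fibre_homotopic_def homotopic_with_def by auto
  define k' where "k' = (\<lambda>(t, a, e). (a::'d, k (t::real, e)))"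
  have 1: "continuous_map (prod_topology ?I ?P) A (\<lambda>z. fst (snd z))"
    using continuous_map_compose[OF continuous_map_snd continuous_map_pullback_fst]
    by (simp add: o_def)
  have "continuous_map (prod_topology ?I ?P) (prod_topology ?I E) (\<lambda>z. (fst z, snd (snd z)))"
    using continuous_map_compose[OF continuous_map_snd continuous_map_pullback_snd]
    by (simp add: continuous_map_paired continuous_map_fst o_def)
  then have 2: "continuous_map (prod_topology ?I ?P) E' (\<lambda>z. k (fst z, snd (snd z)))"
    using continuous_map_compose[OF _ k] by (fastforce simp: o_def)
  have "continuous_map (prod_topology ?I ?P) (pullback_space A r E' q) k'"
    using 1 2 kp
    by (auto simp: continuous_map_pullback_space k'_def o_def split_beta topspace_pullback_space)
  then show ?thesis
    unfolding fibre_homotopic_def homotopic_with_def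
    by (intro exI[of _ k']) (auto simp: k'_def k0 k1)
qed

text \<open>
  Pulling back is functorial on maps over the base and respects fibre homotopies, so it takes an
  inverse up to fibre homotopy to another one.
\<close>

lemma fibre_homotopy_equivalence_pullback:
  assumes "fibre_homotopy_equivalence E p E' q F"
  shows "fibre_homotopy_equivalence (pullback_space A r E p) fst (pullback_space A r E' q) fst
    (map_prod id F)"
proof -
  obtain G where F: "map_over E p E' q F" and G: "map_over E' q E p G"
    and GF: "fibre_homotopic E p E p (G \<circ> F) id"
    and FG: "fibre_homotopic E' q E' q (F \<circ> G) id"
    using assms by (auto simp: fibre_homotopy_equivalence_def)
  have "fibre_homotopic (pullback_space A r E p) fst (pullback_space A r E p) fst
      (map_prod id G \<circ> map_prod id F) id"
    using fibre_homotopic_pullback[OF GF]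
    by (simp add: map_prod.comp map_prod.id)
  moreover have "fibre_homotopic (pullback_space A r E' q) fst (pullback_space A r E' q) fst
      (map_prod id F \<circ> map_prod id G) id"
    using fibre_homotopic_pullback[OF FG]
    by (simp add: map_prod.comp map_prod.id)
  ultimately show ?thesis
    unfolding fibre_homotopy_equivalence_def
    using map_over_pullback[OF F] map_over_pullback[OF G] by blast
qed


section \<open>Functoriality of traces\<close>

lemma dmap_compose:
  assumes f: "dmap X Y f" and g: "dmap Y Z g"
  shows "dmap X Z (g \<circ> f)"
proof -
  have "compose {0..1} (g \<circ> f) p = compose {0..1} g (compose {0..1} f p)" for p :: "real \<Rightarrow> _"
    by (auto simp: compose_def)
  then show ?thesis
    using f g by (auto simp: dmap_def intro: continuous_map_compose)
qed

lemma dmap_reachable_pairs: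
  assumes f: "dmap X Y f" and "(x, y) \<in> reachable_pairs X"
  shows "(f x, f y) \<in> reachable_pairs Y"
proof -
  obtain p where p: "p \<in> dpaths X" "p 0 = x" "p 1 = y"
    using assms(2) by (auto simp: reachable_pairs_def)
  then have "compose {0..1} f p \<in> dpaths Y" using f by (auto simp: dmap_def)
  then show ?thesis
    using p by (auto simp: reachable_pairs_def compose_def
        intro!: bexI[of _ "compose {0..1} f p"])
qed

lemma topspace_trace_spaceE:
  assumes "\<sigma> \<in> topspace (trace_space X)"
  obtains p where "p \<in> dpaths X" and "\<sigma> = trace_of X p"
proof -
  have "openin (trace_space X) (topspace (trace_space X))" by simp
  then have "\<sigma> \<in> trace_of X ` topspace (path_space X)"
    unfolding trace_space_def openin_quotient_topology using assms by (auto simp: trace_space_def)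
  then show ?thesis
    using that by (auto simp: path_space_def)
qed

text \<open>
  Every point of the trace space is the trace of a d-path, and there both sides are computed by
  composing the representative with the maps.
\<close>

lemma trace_map_compose:
  assumes f: "dmap X Y f" and g: "dmap Y Z g" and "\<sigma> \<in> topspace (trace_space X)"
  shows "trace_map Z (g \<circ> f) \<sigma> = trace_map Z g (trace_map Y f \<sigma>)"
proof -
  obtain p where p: "p \<in> dpaths X" and \<sigma>: "\<sigma> = trace_of X p"
    using assms(3) by (rule topspace_trace_spaceE)
  have fp: "compose {0..1} f p \<in> dpaths Y" using f p by (auto simp: dmap_def)
  have "compose {0..1} (g \<circ> f) p = compose {0..1} g (compose {0..1} f p)"
    by (auto simp: compose_def)
  then show ?thesis
    by (simp add: \<sigma> trace_map_trace_of[OF f p] trace_map_trace_of[OF g fp]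
        trace_map_trace_of[OF dmap_compose[OF f g] p])
qed

lemma psp_compose:
  assumes f: "psp X Y f" and g: "psp Y Z g"
  shows "psp X Z (g \<circ> f)"
proof -
  have df: "dmap X Y f" and dg: "dmap Y Z g" using f g by (auto simp: psp_def)
  have "weak_homotopy_equivalence (trace_fibre X x y) (trace_fibre Z ((g \<circ> f) x) ((g \<circ> f) y))
      (trace_map Z (g \<circ> f))" if xy: "(x, y) \<in> reachable_pairs X" for x y
  proof (rule weak_homotopy_equivalence_compose)
    show "weak_homotopy_equivalence (trace_fibre X x y) (trace_fibre Y (f x) (f y)) (trace_map Y f)"
      using f xy by (auto simp: psp_def)
    show "weak_homotopy_equivalence (trace_fibre Y (f x) (f y))
        (trace_fibre Z ((g \<circ> f) x) ((g \<circ> f) y)) (trace_map Z g)"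
      using g dmap_reachable_pairs[OF df xy] by (auto simp: psp_def)
    show "trace_map Z (g \<circ> f) \<sigma> = trace_map Z g (trace_map Y f \<sigma>)"
      if "\<sigma> \<in> topspace (trace_fibre X x y)" for \<sigma>
      using that by (intro trace_map_compose[OF df dg]) (simp add: trace_fibre_def)
  qed
  then show ?thesis
    using dmap_compose[OF df dg] by (auto simp: psp_def)
qed


section \<open>The diagonal composite of two homotopies\<close>

definition diagonal_homotopy ::
    "('b \<times> 't \<Rightarrow> 'c) \<Rightarrow> ('a \<times> 't \<Rightarrow> 'b) \<Rightarrow> 'a \<times> 't \<Rightarrow> 'c"
  where "diagonal_homotopy G H = (\<lambda>(x, t). G (H (x, t), t))"

lemma diagonal_homotopy_level:
  "(\<lambda>x. diagonal_homotopy G H (x, t)) = (\<lambda>x. G (x, t)) \<circ> (\<lambda>x. H (x, t))"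
  by (auto simp: diagonal_homotopy_def)

text \<open>
  The time coordinate of a d-path in \<open>X \<times> J\<close> is a d-path of \<open>J\<close> and can be reused together with the
  image of the path under \<open>H\<close>; whether \<open>J\<close> is directed or neutral makes no difference.
\<close>

lemma dmap_diagonal_homotopy:
  assumes G: "dmap (dprod Y J) Z G" and H: "dmap (dprod X J) Y H"
  shows "dmap (dprod X J) Z (diagonal_homotopy G H)"
proof -
  have *: "dmap (dprod X J) (dprod Y J) (\<lambda>z. (H z, snd z))"
    unfolding dmap_def
  proof (intro conjI ballI)
    show "continuous_map (dtop (dprod X J)) (dtop (dprod Y J)) (\<lambda>z. (H z, snd z))"
      using H by (simp add: dmap_def dprod_def continuous_map_paired continuous_map_snd)
    fix p assume p: "p \<in> dpaths (dprod X J)"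
    let ?q = "compose {0..1} (\<lambda>z. (H z, snd z)) p"
    have "compose {0..1} fst ?q = compose {0..1} H p" "compose {0..1} snd ?q = compose {0..1} snd p"
      by (auto simp: compose_def)
    then show "?q \<in> dpaths (dprod Y J)"
      using H p by (auto simp: dmap_def dprod_def)
  qed
  have "diagonal_homotopy G H = G \<circ> (\<lambda>z. (H z, snd z))"
    by (auto simp: diagonal_homotopy_def)
  then show ?thesis
    using dmap_compose[OF * G] by simp
qed

lemma psp_homotopy_diagonal:
  "psp_homotopy X G \<Longrightarrow> psp_homotopy X H \<Longrightarrow> psp_homotopy X (diagonal_homotopy G H)"
  unfolding psp_homotopy_def diagonal_homotopy_level by (blast intro: psp_compose)

lemma is_homotopy_diagonal:
  assumes "is_homotopy J X f0 f1 H" and "is_homotopy J X g0 g1 G"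
    and "continuous_map (dtop X) (dtop X) f0" and "continuous_map (dtop X) (dtop X) f1"
  shows "is_homotopy J X (g0 \<circ> f0) (g1 \<circ> f1) (diagonal_homotopy G H)"
proof -
  have "f0 x \<in> topspace (dtop X)" "f1 x \<in> topspace (dtop X)" if "x \<in> topspace (dtop X)" for x
    using assms(3,4) that by (auto simp: continuous_map_def)
  then show ?thesis
    using assms(1,2) dmap_diagonal_homotopy
    by (auto simp: is_homotopy_def diagonal_homotopy_def)
qed

text \<open>
  In each variance, one end of a homotopy is the identity and the other the given map; which end is
  which only decides whether the composites at the ends read \<open>id \<circ> id\<close> and \<open>g \<circ> f\<close> or conversely.
\<close>

lemma sign_homotopy_diagonal:
  assumes "sign_homotopy \<alpha> X f H" and "sign_homotopy \<alpha> X g G" and "dmap X X f"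
  shows "sign_homotopy \<alpha> X (g \<circ> f) (diagonal_homotopy G H)"
proof -
  have f: "continuous_map (dtop X) (dtop X) f" using assms(3) by (simp add: dmap_def)
  have i: "continuous_map (dtop X) (dtop X) id" by simp
  show ?thesis
    using assms(1,2) is_homotopy_diagonal[OF _ _ i f] is_homotopy_diagonal[OF _ _ f i]
    by (cases \<alpha>) (force simp: id_def o_def)+
qed

lemma sign_homotopy_continuous:
  "sign_homotopy \<alpha> X f H \<Longrightarrow> continuous_map (prod_topology (dtop X) unit_interval) (dtop X) H"
  by (cases \<alpha>) (auto simp: is_homotopy_def dmap_def dprod_def neutral_interval_def
      directed_interval_def)


section \<open>Coherence of the diagonal composite\<close>

text \<open>
  This is the base change map along which the comparison map of the second homotopy is pulled back.
  It lands in the reachable pairs because each \<open>H\<^sub>t\<close> carries a d-path joining two points to one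
  joining their images.
\<close>

lemma continuous_map_endpoint_homotopy:
  assumes H: "continuous_map (prod_topology (dtop X) unit_interval) (dtop X) H"
    and d: "\<And>t. t \<in> {0..1} \<Longrightarrow> dmap X X (\<lambda>x. H (x, t))"
  shows "continuous_map (prod_topology (reachable_space X) unit_interval)
    (prod_topology (reachable_space X) unit_interval)
    (\<lambda>((x, y), t). ((H (x, t), H (y, t)), t))"
proof -
  let ?A = "prod_topology (reachable_space X) unit_interval"
  have r: "continuous_map (reachable_space X) (prod_topology (dtop X) (dtop X)) id"
    by (simp add: reachable_space_def continuous_map_from_subtopology)
  have c: "continuous_map ?A (prod_topology (dtop X) (dtop X)) fst"
    using continuous_map_compose[OF continuous_map_fst r] by simp
  have c1: "continuous_map ?A (dtop X) (\<lambda>z. fst (fst z))"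
    using continuous_map_compose[OF c continuous_map_fst] by (simp add: o_def)
  have c2: "continuous_map ?A (dtop X) (\<lambda>z. snd (fst z))"
    using continuous_map_compose[OF c continuous_map_snd] by (simp add: o_def)
  have ct: "continuous_map ?A unit_interval snd" by (rule continuous_map_snd)
  have "continuous_map ?A (dtop X) (\<lambda>z. H (fst (fst z), snd z))"
    using continuous_map_compose[OF _ H, of ?A "\<lambda>z. (fst (fst z), snd z)"] c1 ct
    by (simp add: continuous_map_paired o_def)
  moreover have "continuous_map ?A (dtop X) (\<lambda>z. H (snd (fst z), snd z))"
    using continuous_map_compose[OF _ H, of ?A "\<lambda>z. (snd (fst z), snd z)"] c2 ct
    by (simp add: continuous_map_paired o_def)
  moreover have "(H (fst (fst z), snd z), H (snd (fst z), snd z)) \<in> reachable_pairs X"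
    if "z \<in> topspace ?A" for z
    using dmap_reachable_pairs[OF d] that by (auto simp: reachable_space_def)
  ultimately have "continuous_map ?A (reachable_space X)
      (\<lambda>z. (H (fst (fst z), snd z), H (snd (fst z), snd z)))"
    unfolding reachable_space_def by (simp add: continuous_map_into_subtopology
        continuous_map_paired image_subset_iff)
  with ct show ?thesis
    unfolding split_beta by (simp add: continuous_map_paired)
qed

lemma trace_pullback_eq:
  "trace_pullback X H =
    pullback_space (prod_topology (reachable_space X) unit_interval)
      (\<lambda>((x, y), t). (H (x, t), H (y, t))) (trace_space X) trace_ends"
  unfolding trace_pullback_def pullback_space_def
  by (rule arg_cong[where f = "subtopology _"]) auto

text \<open>
  The comparison map of the diagonal composite factors as
  \<open>T \<times> I \<rightarrow> (H\<^sup>2)\<^sup>*T \<cong> h\<^sup>*(T \<times> I) \<rightarrow> h\<^sup>*((G\<^sup>2)\<^sup>*T) \<cong> (K\<^sup>2)\<^sup>*T\<close>, all over the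
  reachable pairs times the unit interval: the first arrow is the comparison
  map of \<open>H\<close>, the second the pullback along \<open>h\<close> of that of \<open>G\<close>.
\<close>

lemma coherently_psp_homotopy_diagonal:
  assumes H: "continuous_map (prod_topology (dtop X) unit_interval) (dtop X) H"
    and cG: "coherently_psp_homotopy X G" and cH: "coherently_psp_homotopy X H"
  shows "coherently_psp_homotopy X (diagonal_homotopy G H)"
proof -
  let ?A = "prod_topology (reachable_space X) unit_interval"
  let ?E = "prod_topology (trace_space X) unit_interval"
  let ?p = "\<lambda>(\<sigma>, t::real). (trace_ends \<sigma> :: 'a \<times> 'a, t)"
  let ?Phi = "\<lambda>K (\<sigma>, t). ((trace_ends \<sigma>, t), trace_map X (\<lambda>x. K (x, t)) \<sigma>)"
  let ?K = "diagonal_homotopy G H"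
  define h where "h = (\<lambda>((x, y), t). ((H (x, t), H (y, t)), t))"
  have pG: "psp_homotopy X G" and pH: "psp_homotopy X H"
    using cG cH by (auto simp: coherently_psp_homotopy_def)
  have dG: "dmap X X (\<lambda>x. G (x, t))" and dH: "dmap X X (\<lambda>x. H (x, t))" if "t \<in> {0..1}" for t
    using pG pH that by (auto simp: psp_homotopy_def psp_def)
  have eG: "fibre_homotopy_equivalence ?E ?p (trace_pullback X G) fst (?Phi G)"
    and eH: "fibre_homotopy_equivalence ?E ?p (trace_pullback X H) fst (?Phi H)"
    using cG cH by (auto simp: coherently_psp_homotopy_def)
  have hA: "continuous_map ?A ?A h"
    unfolding h_def using continuous_map_endpoint_homotopy[OF H dH] .

  let ?hE = "pullback_space ?A h ?E ?p" and ?hG = "pullback_space ?A h (trace_pullback X G) fst"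
  \<comment> \<open>A point of \<open>h\<^sup>*(T \<times> I)\<close> carries its time twice; dropping or duplicating it identifies this space
    with the target of the comparison map of \<open>H\<close>.\<close>
  have e1: "fibre_homotopy_equivalence (trace_pullback X H) fst ?hE fst
      (\<lambda>(b, \<sigma>). (b, \<sigma>, snd b))"
  proof (rule fibre_homeomorphism_imp_fibre_homotopy_equivalence[where G = "\<lambda>(b, \<sigma>, t). (b, \<sigma>)"])
    note c = continuous_map_pullback_fst continuous_map_pullback_snd
    have "continuous_map (trace_pullback X H) unit_interval (snd \<circ> fst)"
      unfolding trace_pullback_eq by (rule continuous_map_compose[OF c(1) continuous_map_snd])
    then show "map_over (trace_pullback X H) fst ?hE fst (\<lambda>(b, \<sigma>). (b, \<sigma>, snd b))"
      using c[of ?A _ "trace_space X" trace_ends]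
      by (auto simp: map_over_def continuous_map_pullback_space trace_pullback_eq
          topspace_pullback_space h_def o_def split_beta continuous_map_paired)
    have "continuous_map ?hE (trace_space X) (fst \<circ> snd)"
      by (rule continuous_map_compose[OF c(2) continuous_map_fst])
    then show "map_over ?hE fst (trace_pullback X H) fst (\<lambda>(b, \<sigma>, t). (b, \<sigma>))"
      using c(1)[of ?A h ?E ?p]
      by (auto simp: map_over_def continuous_map_pullback_space trace_pullback_eq
          topspace_pullback_space h_def o_def split_beta)
  qed (auto simp: topspace_pullback_space h_def)

  have e2: "fibre_homotopy_equivalence ?hE fst ?hG fst (map_prod id (?Phi G))"
    by (rule fibre_homotopy_equivalence_pullback[OF eG])

  \<comment> \<open>A point of \<open>h\<^sup>*((G\<^sup>2)\<^sup>*T)\<close> over \<open>b\<close> carries in addition the base point \<open>h b\<close>, which is determined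
    by \<open>b\<close>; continuity of \<open>h\<close> is what allows it to be restored.\<close>
  have e3: "fibre_homotopy_equivalence ?hG fst (trace_pullback X ?K) fst (\<lambda>(b, c, \<tau>). (b, \<tau>))"
  proof (rule fibre_homeomorphism_imp_fibre_homotopy_equivalence[where G = "\<lambda>(b, \<tau>). (b, h b, \<tau>)"])
    note c = continuous_map_pullback_fst continuous_map_pullback_snd
    have "continuous_map ?hG (trace_space X) (snd \<circ> snd)"
      by (rule continuous_map_compose[OF c(2)]) (simp add: trace_pullback_eq c)
    then show "map_over ?hG fst (trace_pullback X ?K) fst (\<lambda>(b, c, \<tau>). (b, \<tau>))"
      using c(1)[of ?A h "trace_pullback X G" fst]
      unfolding trace_pullback_eq[of X ?K]
      by (auto simp: map_over_def continuous_map_pullback_space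
          topspace_pullback_space h_def o_def split_beta diagonal_homotopy_def
          trace_pullback_eq[of X G])
    have "continuous_map (trace_pullback X ?K) ?A (h \<circ> fst)"
      unfolding trace_pullback_eq by (rule continuous_map_compose[OF c(1) hA])
    then show "map_over (trace_pullback X ?K) fst ?hG fst (\<lambda>(b, \<tau>). (b, h b, \<tau>))"
      using c[of ?A _ "trace_space X" trace_ends]
      by (auto simp: map_over_def continuous_map_pullback_space trace_pullback_eq
          topspace_pullback_space h_def o_def split_beta diagonal_homotopy_def)
  qed (auto simp: topspace_pullback_space)

  have "fibre_homotopy_equivalence ?E ?p (trace_pullback X ?K) fst
      ((\<lambda>(b, c, \<tau>). (b, \<tau>)) \<circ> (map_prod id (?Phi G) \<circ> ((\<lambda>(b, \<sigma>). (b, \<sigma>, snd b)) \<circ> ?Phi H)))"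
    by (intro fibre_homotopy_equivalence_compose[OF _ e3]
        fibre_homotopy_equivalence_compose[OF _ e2] fibre_homotopy_equivalence_compose[OF eH e1])
  then have "fibre_homotopy_equivalence ?E ?p (trace_pullback X ?K) fst (?Phi ?K)"
  proof (rule fibre_homotopy_equivalence_eq)
    fix e assume "e \<in> topspace ?E"
    then obtain \<sigma> t where e: "e = (\<sigma>, t)" "\<sigma> \<in> topspace (trace_space X)" "t \<in> {0..1}"
      by auto
    show "?Phi ?K e = ((\<lambda>(b, c, \<tau>). (b, \<tau>)) \<circ>
        (map_prod id (?Phi G) \<circ> ((\<lambda>(b, \<sigma>). (b, \<sigma>, snd b)) \<circ> ?Phi H))) e"
      by (simp add: e(1) diagonal_homotopy_level trace_map_compose[OF dH[OF e(3)] dG[OF e(3)] e(2)])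
  qed
  then show ?thesis
    using psp_homotopy_diagonal[OF pG pH] by (simp add: coherently_psp_homotopy_def)
qed


section \<open>Closure under composition\<close>

theorem lemma2p8:
  fixes X :: "'a dspace" and \<alpha> :: sign
  assumes "is_dspace X"
  shows "(\<forall>f g. inessential \<alpha> X f \<and> inessential \<alpha> X g \<longrightarrow> inessential \<alpha> X (g \<circ> f)) \<and>
    (\<forall>f g. coherently_inessential \<alpha> X f \<and> coherently_inessential \<alpha> X g \<longrightarrow>
       coherently_inessential \<alpha> X (g \<circ> f))"
proof (intro conjI allI impI)
  fix f g assume "inessential \<alpha> X f \<and> inessential \<alpha> X g"
  then show "inessential \<alpha> X (g \<circ> f)"
    unfolding inessential_def
    by (blast intro: dmap_compose sign_homotopy_diagonal psp_homotopy_diagonal)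
next
  fix f g assume "coherently_inessential \<alpha> X f \<and> coherently_inessential \<alpha> X g"
  then show "coherently_inessential \<alpha> X (g \<circ> f)"
    unfolding coherently_inessential_def
    by (blast intro: dmap_compose sign_homotopy_diagonal
        coherently_psp_homotopy_diagonal[OF sign_homotopy_continuous])
qed

end
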